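(* Let $n\ge1$ and let $x\in\mathbb{R}^n$ with $x\ge0$ (entrywise). Then the nonnegative matrix $P_x$ is diagonalizable.
   Context: For $x\in\mathbb{C}^n$, $P_x$ denotes the $n\times n$ matrix whose first row is $(x_1,x_2,\dots,x_n)$ and whose $i$-th row, for $i\ge 2$, is obtained from the first row by interchanging its first and $i$-th entries. That is, $(P_x)_{1j}=x_j$ for all $j$, and for $i\ge2$: $(P_x)_{i1}=x_i$, $(P_x)_{ii}=x_1$, and $(P_x)_{ij}=x_j$ for $j\notin\{1,i\}$. *)

theory Defs
  imports "Jordan_Normal_Form.Matrix" Complex_Main
begin

text \<open>Rows, columns and vector entries are numbered from 0, so index 0 here is index 1 of the
  usual notation. The entry type is arbitrary: \<^typ>\<open>complex\<close> gives the matrix of a complex vector,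
  \<^typ>\<open>real\<close> that of a real vector.\<close>

definition permutative_mat :: "'a vec \<Rightarrow> 'a mat" where
  "permutative_mat x = mat (dim_vec x) (dim_vec x) (\<lambda>(i, j).
     if i = 0 then x $ j
     else if j = 0 then x $ i
     else if j = i then x $ 0
     else x $ j)"

text \<open>Diagonalizability is over the entry type of the matrix.\<close>

definition diagonalizable :: "'a :: field mat \<Rightarrow> bool" where
  "diagonalizable A \<longleftrightarrow> (\<exists>D. diagonal_mat D \<and> similar_mat A D)"

text \<open>A real matrix that is diagonalizable over the reals is diagonalizable over the complex
  numbers, so for the matrix of a real vector the real notion yields the complex one.\<close>

lemma permutative_mat_of_real:
  "permutative_mat (map_vec complex_of_real x) = map_mat complex_of_real (permutative_mat x)"
  by (rule eq_matI) (auto simp: permutative_mat_def)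

lemma diagonalizable_of_real:
  assumes "diagonalizable A"
  shows "diagonalizable (map_mat complex_of_real A)"
proof -
  from assms obtain D P Q where D: "diagonal_mat D" and w: "similar_mat_wit A D P Q"
    unfolding diagonalizable_def similar_mat_def by blast
  define n where "n = dim_row A"
  note s = similar_mat_witD[OF n_def w]
  let ?h = "map_mat complex_of_real"
  note m = of_real_hom.mat_hom_mult
  have PQ: "?h P * ?h Q = 1\<^sub>m n"
    using m[OF s(6) s(7)] unfolding s(1) of_real_hom.mat_hom_one by (rule sym)
  have QP: "?h Q * ?h P = 1\<^sub>m n"
    using m[OF s(7) s(6)] unfolding s(2) of_real_hom.mat_hom_one by (rule sym)
  have "?h (P * D * Q) = ?h P * ?h D * ?h Q"
    unfolding m[OF mult_carrier_mat[OF s(6) s(5)] s(7)] m[OF s(6) s(5)] ..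
  then have A: "?h A = ?h P * ?h D * ?h Q"
    unfolding s(3)[symmetric] .
  have "similar_mat (?h A) (?h D)"
    by (rule similar_matI[OF _ PQ QP A]) (use s(4-7) in simp)
  moreover have "diagonal_mat (?h D)"
    using D by (simp add: diagonal_mat_def)
  ultimately show ?thesis
    unfolding diagonalizable_def by blast
qed

end

theory Submission
  imports Defs "Jordan_Normal_Form.Determinant"
begin

text \<open>Let \<open>S\<close> be the sum of the entries of \<open>x\<close>. The matrix sends \<open>v\<close> to the vector with entries
  \<open>x \<bullet> v + (x\<^sub>0 - x\<^sub>i) (v\<^sub>i - v\<^sub>0)\<close>. Hence the all-ones vector is an eigenvector for \<open>S\<close>, and for
  \<open>j \<noteq> 0\<close> the unit vector \<open>e\<^sub>j\<close> minus \<open>c\<close> times the all-ones vector is an eigenvector for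
  \<open>x\<^sub>0 - x\<^sub>j\<close> as soon as \<open>c (S - x\<^sub>0 + x\<^sub>j) = x\<^sub>j\<close>. For nonnegative \<open>x\<close> such a \<open>c\<close> exists: if the
  factor vanishes, then so does \<open>x\<^sub>j\<close>.\<close>

text \<open>A right inverse \<open>Q\<close> is enough, because for square matrices over a field it
  is also a left inverse.\<close>

lemma diagonalizable_if_eigenbasis:
  fixes A :: "'a :: field mat"
  assumes A: "A \<in> carrier_mat n n" and P: "P \<in> carrier_mat n n" and Q: "Q \<in> carrier_mat n n"
    and D: "D \<in> carrier_mat n n" "diagonal_mat D"
    and PQ: "P * Q = 1\<^sub>m n" and AP: "A * P = P * D"
  shows "diagonalizable A"
proof -
  have "P * D * Q = A * (P * Q)"
    unfolding AP[symmetric] by (rule assoc_mult_mat[OF A P Q])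
  with PQ A have "A = P * D * Q" by simp
  moreover have "Q * P = 1\<^sub>m n"
    by (rule mat_mult_left_right_inverse[OF P Q PQ])
  ultimately have "similar_mat A D"
    using assms by (intro similar_matI[of _ _ P Q n]) auto
  with D show ?thesis unfolding diagonalizable_def by blast
qed

text \<open>Row \<open>i\<close> is \<open>x\<close> with two entries swapped, so
  \<open>x $ 0 * v 0 + x $ i * v i\<close> becomes \<open>x $ i * v 0 + x $ 0 * v i\<close>; the
  correction is the difference, which is zero for \<open>i = 0\<close>.\<close>

lemma permutative_mat_mult_vec_index:
  fixes x :: "'a :: comm_ring_1 vec"
  assumes "x \<in> carrier_vec n" "i < n"
  shows "(\<Sum>k = 0..<n. permutative_mat x $$ (i, k) * v k) =
    (\<Sum>k = 0..<n. x $ k * v k) + (x $ 0 - x $ i) * (v i - v 0)"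
proof -
  have "(\<Sum>k = 0..<n. permutative_mat x $$ (i, k) * v k) =
    (\<Sum>k = 0..<n. x $ k * v k + ((if k = i then (x $ 0 - x $ i) * v k else 0)
      - (if k = 0 then (x $ 0 - x $ i) * v k else 0)))"
    using assms by (intro sum.cong) (auto simp: permutative_mat_def algebra_simps)
  also have "\<dots> = (\<Sum>k = 0..<n. x $ k * v k) + (x $ 0 - x $ i) * (v i - v 0)"
    using assms(2) by (simp add: sum.distrib sum_subtractf algebra_simps)
  finally show ?thesis .
qed

text \<open>Isolates the algebra, valid over any field; nonnegativity enters later, only to supply
  \<open>c\<close>.\<close>

lemma diagonalizable_permutative_mat:
  fixes x :: "'a :: field vec" and c :: "nat \<Rightarrow> 'a"
  assumes n: "n \<ge> 1" and x: "x \<in> carrier_vec n"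
    and c: "\<And>j. 0 < j \<Longrightarrow> j < n \<Longrightarrow> c j * ((\<Sum>k = 0..<n. x $ k) - x $ 0 + x $ j) = x $ j"
  shows "diagonalizable (permutative_mat x)"
proof -
  define S where "S = (\<Sum>k = 0..<n. x $ k)"
  define p where "p i j = (if j = 0 then 1 else of_bool (i = j) - c j)" for i j :: nat
  \<comment> \<open>Read off by solving \<open>P y = v\<close>: row 0 and row \<open>i\<close>
    differ by \<open>y i\<close>, so \<open>y i = v i - v 0\<close> for \<open>i > 0\<close>, and
    row 0 then gives \<open>y 0 = v 0\<close> plus the sum of \<open>c k * (v k - v 0)\<close> over
    \<open>k > 0\<close>.\<close>
  define q where "q i j = (if i = 0 then if j = 0 then 1 - (\<Sum>k = 1..<n. c k) else c j
    else if j = 0 then - 1 else of_bool (i = j))" for i j :: nat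
  define d where "d j = (if j = 0 then S else x $ 0 - x $ j)" for j :: nat
  define A where "A = permutative_mat x"
  define P where "P = mat n n (\<lambda>(i, j). p i j)"
  define Q where "Q = mat n n (\<lambda>(i, j). q i j)"
  define D where "D = mat n n (\<lambda>(i, j). if i = j then d j else 0)"
  have A: "A \<in> carrier_mat n n"
    using x by (auto simp: A_def permutative_mat_def)
  have "P * Q = 1\<^sub>m n"
  proof (rule eq_matI)
    fix i j assume "i < dim_row (1\<^sub>m n :: 'a mat)" "j < dim_col (1\<^sub>m n :: 'a mat)"
    then have ij: "i < n" "j < n" by simp_all
    have "(P * Q) $$ (i, j) = (\<Sum>k = 0..<n. p i k * q k j)"
      using ij by (simp add: P_def Q_def scalar_prod_def)
    also have "\<dots> = q 0 j + (\<Sum>k = 1..<n. (of_bool (i = k) - c k) * q k j)"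
      using n by (simp add: sum.atLeast_Suc_lessThan p_def)
    also have "(\<Sum>k = 1..<n. (of_bool (i = k) - c k) * q k j) =
        (\<Sum>k = 1..<n. if k = i then q k j else 0) - (\<Sum>k = 1..<n. c k * q k j)"
      unfolding sum_subtractf[symmetric] by (intro sum.cong) (auto simp: algebra_simps)
    also have "(\<Sum>k = 1..<n. c k * q k j) =
        (if j = 0 then - (\<Sum>k = 1..<n. c k) else \<Sum>k = 1..<n. if k = j then c k else 0)"
      by (auto simp: q_def sum_negf[symmetric] intro!: sum.cong)
    finally show "(P * Q) $$ (i, j) = 1\<^sub>m n $$ (i, j)"
      using ij by (auto simp: q_def)
  qed (simp_all add: P_def Q_def)
  moreover have "A * P = P * D"
  proof (rule eq_matI)
    fix i j assume "i < dim_row (P * D)" "j < dim_col (P * D)"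
    then have ij: "i < n" "j < n" by (simp_all add: P_def D_def)
    have s: "(\<Sum>k = 0..<n. x $ k * p k j) = (if j = 0 then S else x $ j - c j * S)"
    proof -
      have "(\<Sum>k = 0..<n. x $ k * (of_bool (k = j) - c j)) =
        (\<Sum>k = 0..<n. (if k = j then x $ k else 0) - c j * x $ k)"
        by (intro sum.cong) (auto simp: algebra_simps)
      with ij show ?thesis
        by (simp add: p_def S_def sum_subtractf sum_distrib_left)
    qed
    have "(A * P) $$ (i, j) = (\<Sum>k = 0..<n. A $$ (i, k) * p k j)"
      using A ij by (simp add: P_def scalar_prod_def)
    also have "\<dots> = (if j = 0 then S else x $ j - c j * S) + (x $ 0 - x $ i) * (p i j - p 0 j)"
      unfolding A_def permutative_mat_mult_vec_index[OF x ij(1)] s ..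
    \<comment> \<open>For \<open>j > 0\<close> the hypothesis on \<open>c\<close> rearranges to
      \<open>x $ j - c j * S = - c j * (x $ 0 - x $ j)\<close>, and \<open>p i j - p 0 j\<close> is
      1 exactly in row \<open>j\<close>.\<close>
    also have "\<dots> = p i j * d j"
      using c[OF _ ij(2)] by (auto simp: p_def d_def S_def algebra_simps)
    also have "\<dots> = (\<Sum>k = 0..<n. if k = j then p i k * d k else 0)"
      using ij by simp
    also have "\<dots> = (\<Sum>k = 0..<n. p i k * (if k = j then d j else 0))"
      by (intro sum.cong) auto
    also have "\<dots> = (P * D) $$ (i, j)"
      using ij by (simp add: P_def D_def scalar_prod_def)
    finally show "(A * P) $$ (i, j) = (P * D) $$ (i, j)" .
  qed (use A in \<open>simp_all add: P_def D_def\<close>)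
  ultimately show ?thesis
    using A unfolding A_def
    by (intro diagonalizable_if_eigenbasis[of _ n P Q D])
      (simp_all add: P_def Q_def D_def diagonal_mat_def)
qed

theorem theorem3p2:
  fixes n :: nat and x :: "real vec"
  assumes "n \<ge> 1"
    and "x \<in> carrier_vec n"
    and "0\<^sub>v n \<le> x"
  shows "diagonalizable (permutative_mat x)"
proof (rule diagonalizable_permutative_mat[OF assms(1,2)])
  let ?d = "\<lambda>j. (\<Sum>k = 0..<n. x $ k) - x $ 0 + x $ j"
  fix j assume j: "0 < j" "j < n"
  have nonneg: "x $ k \<ge> 0" if "k < n" for k
    using assms(2,3) that by (auto simp: less_eq_vec_def)
  have "?d j = (\<Sum>k = 1..<n. x $ k) + x $ j"
    using assms(1) by (simp add: sum.atLeast_Suc_lessThan)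
  moreover have "(\<Sum>k = 1..<n. x $ k) \<ge> 0"
    using nonneg by (intro sum_nonneg) auto
  ultimately have "?d j = 0 \<Longrightarrow> x $ j = 0"
    using nonneg[OF j(2)] by linarith
  \<comment> \<open>This fixes \<open>c j\<close> as \<open>x $ j / ?d j\<close>. If
    \<open>?d j = 0\<close>, the quotient is 0 by convention and the equation reduces to
    \<open>x $ j = 0\<close>.\<close>
  then show "x $ j / ?d j * ?d j = x $ j"
    by auto
qed

end
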